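(* Let $G$ be a finite abelian group and let $x, y \in G$. Then there exists an automorphism $\phi \in \operatorname{Aut}(G)$ with $\phi(x) = y$ if and only if $G/\langle x \rangle \cong G/\langle y \rangle$.
   Context: $G$ is written additively; $\langle x\rangle$ denotes the cyclic subgroup generated by $x$, and $\operatorname{Aut}(G)$ is the group of group automorphisms of $G$. *)

theory Defs
  imports "HOL-Algebra.Algebra"
begin

end

theory Submission
  imports Defs
begin

text \<open>
  The nontrivial direction counts homomorphisms, in the spirit of Lovasz. For a finite abelian
  group \<open>A\<close>, the evaluation \<open>f \<mapsto> f x\<close> from \<open>Hom(G, A)\<close> to \<open>A\<close> has as its image a subgroup \<open>I\<^sub>x\<close>, and all
  its nonempty fibres have \<open>|Hom(G/\<langle>x\<rangle>, A)|\<close> elements. Hence the fibres and images for \<open>x\<close> and \<open>y\<close> have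
  the same sizes. If \<open>A\<close> is cyclic, then \<open>I\<^sub>x = I\<^sub>y\<close>, since a subgroup of a finite cyclic group is determined
  by its order; decomposing \<open>A\<close> into cyclic factors gives \<open>I\<^sub>x = I\<^sub>y\<close> in general. So there are
  as many homomorphisms from \<open>G\<close> to \<open>A\<close> with \<open>x \<mapsto> y\<close> as with \<open>y \<mapsto> y\<close>, for each subgroup \<open>A\<close> of \<open>G\<close>
  containing \<open>y\<close>. By induction over the subgroups the same holds for surjective homomorphisms
  from \<open>G\<close> to \<open>G\<close>. The identity is one with \<open>y \<mapsto> y\<close>, so there is one with \<open>x \<mapsto> y\<close>, and it is an
  automorphism because \<open>G\<close> is finite.
\<close>

section \<open>Cyclic direct factors of finite abelian groups\<close>

lemma (in group) subgroup_nat_pow_closed: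
  assumes "subgroup L G" "a \<in> L"
  shows "a [^] (n::nat) \<in> L"
  using subgroup_int_pow_closed[OF assms, of "int n"] by (simp add: int_pow_int)

text \<open>Bezout's identity writes the gcd as an integer combination of \<open>i\<close> and
  \<open>j\<close>. The typical use has \<open>i\<close> prime and \<open>j\<close> not a multiple
  of it, which puts \<open>a\<close> itself into \<open>L\<close>.\<close>

lemma (in group) subgroup_pow_gcd:
  fixes i j :: nat
  assumes L: "subgroup L G" and a: "a \<in> carrier G" "a [^] i \<in> L" "a [^] j \<in> L"
  shows "a [^] gcd i j \<in> L"
proof -
  obtain u v where uv: "u * int i + v * int j = int (gcd i j)"
    using bezout_int[of "int i" "int j"] by auto
  have "a [^] gcd i j = (a [^] i) [^] u \<otimes> (a [^] j) [^] v"
    using a(1) by (metis int_pow_int int_pow_mult int_pow_pow mult.commute uv)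
  then show ?thesis
    using subgroup_int_pow_closed[OF L] a L by (simp add: subgroup.m_closed)
qed

lemma (in comm_group) ord_mult_coprime:
  assumes u: "u \<in> carrier G" and v: "v \<in> carrier G" and cop: "coprime (ord u) (ord v)"
  shows "ord (u \<otimes> v) = ord u * ord v"
proof (rule dvd_antisym)
  show "ord (u \<otimes> v) dvd ord u * ord v"
    using u v by (rule abelian_ord_mul_divides)
  have *: "ord a dvd ord (a \<otimes> b)"
    if ab: "a \<in> carrier G" "b \<in> carrier G" "coprime (ord a) (ord b)" for a b
  proof -
    \<comment> \<open>This exponent kills both the product and \<open>b\<close>, hence also
      \<open>a\<close>. Coprimality then removes the factor \<open>ord b\<close>.\<close>
    let ?k = "ord (a \<otimes> b) * ord b"
    have "(a \<otimes> b) [^] ?k = \<one>"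
      using ab by (simp add: pow_eq_id)
    moreover have "(a \<otimes> b) [^] ?k = a [^] ?k \<otimes> b [^] ?k"
      using ab by (simp add: pow_mult_distrib m_comm)
    moreover have "b [^] ?k = \<one>"
      using ab by (simp add: pow_eq_id)
    ultimately have "ord a dvd ?k"
      using ab by (simp add: pow_eq_id)
    then show ?thesis
      using ab(3) by (simp add: coprime_dvd_mult_left_iff)
  qed
  show "ord u * ord v dvd ord (u \<otimes> v)"
    using *[OF u v cop] *[OF v u] cop by (simp add: divides_mult coprime_commute m_comm u v)
qed

text \<open>An element \<open>g\<close> of maximal order works. If \<open>ord a\<close> did not
  divide \<open>ord g\<close>, some prime would occur in \<open>ord a\<close> to a higher power; the
  part of \<open>g\<close> prime to \<open>p\<close> times the \<open>p\<close>-part of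
  \<open>a\<close> would then have order larger than \<open>ord g\<close>.\<close>

lemma (in comm_group) exponent_eq_ord:
  assumes fin: "finite (carrier G)"
  obtains g where "g \<in> carrier G" "\<And>a. a \<in> carrier G \<Longrightarrow> ord a dvd ord g"
proof -
  obtain g where g: "g \<in> carrier G" and gmax: "\<And>a. a \<in> carrier G \<Longrightarrow> ord a \<le> ord g"
    using ex_has_greatest_nat[of "\<lambda>a. a \<in> carrier G" \<one> ord "Suc (order G)"] ord_le_group_order[OF fin]
    by (auto simp: less_Suc_eq_le)
  have "ord a dvd ord g" if a: "a \<in> carrier G" for a
  proof (rule ccontr)
    assume nd: "\<not> ord a dvd ord g"
    have pos: "ord a \<noteq> 0" "ord g \<noteq> 0"
      using ord_ge_1[OF fin a] ord_ge_1[OF fin g] by auto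
    then obtain p where p: "Factorial_Ring.prime p" "multiplicity p (ord g) < multiplicity p (ord a)"
      using nd multiplicity_le_imp_dvd[of "ord a" "ord g"] by (meson not_le)
    let ?i = "multiplicity p (ord g)" and ?j = "multiplicity p (ord a)"
    obtain n where n: "ord g = p ^ ?i * n" "\<not> p dvd n"
      using multiplicity_decompose'[of "ord g" p] p(1) pos not_prime_unit by blast
    obtain m where m: "ord a = p ^ ?j * m" "\<not> p dvd m"
      using multiplicity_decompose'[of "ord a" p] p(1) pos not_prime_unit by blast
    have p0: "p \<noteq> 0" "m \<noteq> 0" "n \<noteq> 0" using p m n by (auto intro: Nat.gr0I)
    have 1: "ord (g [^] (p ^ ?i)) = n"
      using ord_pow[OF g, of "p ^ ?i"] p0 n(1)
      by (metis dvd_triv_left nonzero_mult_div_cancel_left power_not_zero)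
    have 2: "ord (a [^] m) = p ^ ?j"
      using ord_pow[OF a, of m] p0 m(1)
      by (metis dvd_triv_right nonzero_mult_div_cancel_right)
    have "coprime n (p ^ ?j)"
      using n(2) p(1) by (metis coprime_commute coprime_power_left_iff prime_imp_coprime)
    then have "ord (g [^] (p ^ ?i) \<otimes> a [^] m) = n * p ^ ?j"
      using ord_mult_coprime 1 2 a g by simp
    moreover have "n * p ^ ?j > ord g"
      using p p0 prime_gt_1_nat[OF p(1)] by (subst n(1)) (simp add: mult.commute)
    ultimately show False
      using gmax[of "g [^] (p ^ ?i) \<otimes> a [^] m"] a g by simp
  qed
  with g that show thesis by blast
qed

text \<open>\<open>K\<close> is taken maximal among the subgroups that meet
  \<open>generate G {g}\<close> trivially. The order condition on \<open>g\<close> is what allows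
  the extraction of a \<open>q\<close>-th root of the cyclic component of a \<open>q\<close>-th
  power.\<close>

lemma (in comm_group) cyclic_complement:
  assumes fin: "finite (carrier G)" and g: "g \<in> carrier G"
    and exp: "\<And>a. a \<in> carrier G \<Longrightarrow> ord a dvd ord g"
  obtains K where "subgroup K G" "K \<inter> generate G {g} \<subseteq> {\<one>}" "K <#> generate G {g} = carrier G"
proof -
  let ?C = "generate G {g}" and ?n = "ord g"
  have C: "subgroup ?C G"
    using g by (simp add: generate_is_subgroup)
  have n0: "?n \<noteq> 0"
    using ord_ge_1[OF fin g] by simp
  let ?S = "{K. subgroup K G \<and> K \<inter> ?C \<subseteq> {\<one>}}"
  have "finite ?S"
    by (rule finite_subset[of _ "Pow (carrier G)"]) (auto simp: fin dest: subgroup.subset)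
  moreover have "?S \<noteq> {}"
    using triv_subgroup by blast
  ultimately obtain K where "K \<in> ?S" and Kmax: "\<forall>K'\<in>?S. K \<subseteq> K' \<longrightarrow> K = K'"
    using finite_has_maximal[of ?S] by blast
  then have K: "subgroup K G" and KC: "K \<inter> ?C \<subseteq> {\<one>}"
    by auto
  let ?L = "K <#> ?C"
  have L: "subgroup ?L G"
    using mult_subgroups[OF K C] .
  have KL: "K \<subseteq> ?L" and CL: "?C \<subseteq> ?L"
    using subgroup.one_closed[OF K] subgroup.one_closed[OF C] subgroup.subset[OF K] subgroup.subset[OF C]
    by (force simp: set_mult_def)+
  \<comment> \<open>Otherwise some \<open>b\<close> outside \<open>?L\<close> has \<open>b\<^sup>q\<close> (with \<open>q\<close> prime) in \<open>K\<close>, and adjoining \<open>b\<close> to \<open>K\<close> contradicts maximality.\<close>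
  have "carrier G \<subseteq> ?L"
  proof (rule ccontr)
    assume "\<not> carrier G \<subseteq> ?L"
    then obtain a\<^sub>0 where a0: "a\<^sub>0 \<in> carrier G" "a\<^sub>0 \<notin> ?L"
      by blast
    \<comment> \<open>\<open>d\<close> is the order of \<open>a\<^sub>0\<close> modulo
      \<open>?L\<close>. For a prime \<open>q\<close> dividing \<open>d\<close>, the power
      \<open>a\<close> of \<open>a\<^sub>0\<close> defined below has order exactly \<open>q\<close>
      modulo \<open>?L\<close>.\<close>
    define d where "d = (LEAST d. d > 0 \<and> a\<^sub>0 [^] (d::nat) \<in> ?L)"
    have "ord a\<^sub>0 > 0 \<and> a\<^sub>0 [^] ord a\<^sub>0 \<in> ?L"
      using ord_ge_1[OF fin a0(1)] a0 subgroup.one_closed[OF L] by simp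
    then have d: "d > 0" "a\<^sub>0 [^] d \<in> ?L"
      unfolding d_def by (metis (mono_tags, lifting) LeastI)+
    have dmin: "a\<^sub>0 [^] e \<notin> ?L" if "0 < e" "e < d" for e
      using that not_less_Least unfolding d_def by blast
    have "d \<noteq> 1"
      using a0 d by auto
    then obtain q where q: "Factorial_Ring.prime q" "q dvd d"
      using prime_factor_nat by blast
    define a where "a = a\<^sub>0 [^] (d div q)"
    have a: "a \<in> carrier G"
      by (simp add: a_def a0)
    have aL: "a \<notin> ?L"
      unfolding a_def using d(1) q prime_gt_1_nat[OF q(1)]
      by (intro dmin) (auto simp: div_greater_zero_iff dvd_imp_le prime_gt_0_nat)
    have aq: "a [^] q \<in> ?L"
      using d q a0 by (simp add: a_def nat_pow_pow)
    have an: "a [^] ?n = \<one>"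
      using exp[OF a] a pow_eq_id by blast
    then have "a [^] ?n \<in> ?L"
      using subgroup.one_closed[OF L] by simp
    then have "a [^] gcd q ?n \<in> ?L"
      using subgroup_pow_gcd[OF L a aq] by blast
    then have "gcd q ?n \<noteq> 1"
      using aL a by auto
    then have "q dvd ?n"
      using q(1) by (metis coprime_iff_gcd_eq_1 prime_imp_coprime)
    then obtain n' where n': "?n = q * n'"
      by blast
    obtain k c where k: "k \<in> K" and c: "c \<in> ?C" and kc: "a [^] q = k \<otimes> c"
      using aq by (auto simp: set_mult_def)
    obtain m :: nat where m: "c = g [^] m"
      using c generate_pow_nat[OF g n0] by auto
    have kG: "k \<in> carrier G"
      using k K by (meson subgroup.mem_carrier)
    \<comment> \<open>Both sides equal \<open>a [^] ?n\<close>, which is trivial. So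
      \<open>g [^] (m * n')\<close> lies in \<open>K\<close> as well as in \<open>?C\<close> and is
      trivial; thus \<open>q * n'\<close> divides \<open>m * n'\<close>, and \<open>q\<close>
      divides \<open>m\<close>.\<close>
    have "k [^] n' \<otimes> g [^] (m * n') = (a [^] q) [^] n'"
      using kG g by (simp add: kc m nat_pow_distrib nat_pow_pow)
    also have "\<dots> = \<one>"
      using an a n' by (simp add: nat_pow_pow)
    finally have "g [^] (m * n') = inv (k [^] n')"
      using kG g by (metis inv_equality inv_inv nat_pow_closed)
    moreover have "inv (k [^] n') \<in> K"
      using subgroup_nat_pow_closed[OF K k] K by (simp add: subgroup.m_inv_closed)
    moreover have "g [^] (m * n') \<in> ?C"
      using generate_pow_nat[OF g n0] by blast
    ultimately have "g [^] (m * n') = \<one>"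
      using KC by auto
    then have "q dvd m"
      using pow_eq_id[OF g, of "m * n'"] n' n0 by simp
    then obtain m' where m': "m = q * m'"
      by blast
    \<comment> \<open>Dividing \<open>a\<close> by a \<open>q\<close>-th root of \<open>c\<close>
      keeps it outside \<open>?L\<close>, since the root lies in \<open>?C\<close>, and leaves
      \<open>b [^] q = k\<close>.\<close>
    define b where "b = a \<otimes> inv (g [^] m')"
    have b: "b \<in> carrier G"
      using a g by (simp add: b_def)
    have "g [^] m' \<in> ?L"
      using generate_pow_nat[OF g n0] CL by blast
    moreover have "a = b \<otimes> g [^] m'"
      using a g by (simp add: b_def m_assoc)
    ultimately have bL: "b \<notin> ?L"
      using aL subgroup.m_closed[OF L] by metis
    have "b [^] q = k \<otimes> c \<otimes> inv (g [^] m)"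
      using a g by (simp add: b_def nat_pow_distrib kc nat_pow_inv nat_pow_pow m' mult.commute)
    then have bq: "b [^] q \<in> K"
      using k kG g m by (simp add: m_assoc)
    have ob: "ord b \<noteq> 0"
      using ord_ge_1[OF fin b] by simp
    let ?K = "K <#> generate G {b}"
    have gb: "subgroup (generate G {b}) G"
      using b by (simp add: generate_is_subgroup)
    have "subgroup ?K G"
      using mult_subgroups[OF K gb] .
    moreover have "K \<subseteq> ?K"
      using subgroup.one_closed[OF gb] subgroup.subset[OF K] by (force simp: set_mult_def)
    moreover have "b \<in> ?K"
      using subgroup.one_closed[OF K] b generate.incl[of b "{b}" G] by (force simp: set_mult_def)
    then have "?K \<noteq> K"
      using bL KL by blast
    ultimately have "\<not> ?K \<inter> ?C \<subseteq> {\<one>}"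
      using Kmax by blast
    then obtain k' and j :: nat where k': "k' \<in> K" and kb: "k' \<otimes> b [^] j \<in> ?C" "k' \<otimes> b [^] j \<noteq> \<one>"
      using generate_pow_nat[OF b ob] by (auto simp: set_mult_def)
    have k'G: "k' \<in> carrier G"
      using k' K by (meson subgroup.mem_carrier)
    show False
    \<comment> \<open>If \<open>q\<close> divides \<open>j\<close>, then \<open>b [^] j\<close> lies
      in \<open>K\<close>, so the nontrivial element found lies in \<open>K\<close> and in
      \<open>?C\<close>. Otherwise both \<open>b [^] q\<close> and \<open>b [^] j\<close> lie in
      \<open>?L\<close> with coprime exponents, which forces \<open>b\<close> into
      \<open>?L\<close>.\<close>
    proof (cases "q dvd j")
      case True
      then obtain j' where "j = q * j'"
        by blast
      then have "b [^] j \<in> K"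
        using subgroup_nat_pow_closed[OF K bq, of j'] b by (simp add: nat_pow_pow)
      then show False
        using kb KC subgroup.m_closed[OF K k'] by blast
    next
      case False
      have "b [^] j = inv k' \<otimes> (k' \<otimes> b [^] j)"
        using k'G b by (simp add: m_assoc[symmetric])
      moreover have "inv k' \<otimes> (k' \<otimes> b [^] j) \<in> ?L"
        using kb(1) subgroup.m_inv_closed[OF K k'] by (auto simp: set_mult_def)
      ultimately have "b [^] gcd q j \<in> ?L"
        using subgroup_pow_gcd[OF L b, of q j] bq KL by auto
      moreover have "gcd q j = 1"
        using False q(1) by (metis coprime_iff_gcd_eq_1 prime_imp_coprime)
      ultimately show False
        using bL b by simp
    qed
  qed
  then have "?L = carrier G"
    using subgroup.subset[OF L] by blast
  with K KC that show thesis by blast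
qed

section \<open>Counting homomorphisms\<close>

text \<open>Extensional functions only, so that there are finitely many homomorphisms to count.\<close>
definition Homs :: "('a, 'c) monoid_scheme \<Rightarrow> ('b, 'd) monoid_scheme \<Rightarrow> ('a \<Rightarrow> 'b) set"
  where "Homs G A = hom G A \<inter> extensional (carrier G)"

lemma finite_Homs:
  assumes "finite (carrier G)" "finite (carrier A)"
  shows "finite (Homs G A)"
proof (rule finite_subset)
  show "finite (carrier G \<rightarrow>\<^sub>E carrier A)"
    using assms by (simp add: finite_PiE)
qed (auto simp: Homs_def hom_def PiE_def)

lemma Homs_eqI:
  assumes "f \<in> Homs G A" "g \<in> Homs G A" "\<And>z. z \<in> carrier G \<Longrightarrow> f z = g z"
  shows "f = g"
  using assms by (auto simp: Homs_def intro: extensionalityI)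

lemma (in group) restrict_in_Homs:
  "f \<in> hom G A \<Longrightarrow> restrict f (carrier G) \<in> Homs G A"
  by (auto simp: Homs_def hom_def)

text \<open>Precomposition with a surjection is injective. Applied to an isomorphism and to its
  inverse, this shows that the count is an isomorphism invariant.\<close>

lemma (in group) card_Homs_epi_le:
  assumes "\<phi> \<in> epi G H" "finite (Homs G A)"
  shows "card (Homs H A) \<le> card (Homs G A)"
proof (rule card_inj_on_le)
  show "inj_on (\<lambda>f. restrict (f \<circ> \<phi>) (carrier G)) (Homs H A)"
  proof (rule inj_onI)
    fix f g assume fg: "f \<in> Homs H A" "g \<in> Homs H A"
      "restrict (f \<circ> \<phi>) (carrier G) = restrict (g \<circ> \<phi>) (carrier G)"
    have "f (\<phi> z) = g (\<phi> z)" if "z \<in> carrier G" for z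
      using fun_cong[OF fg(3), of z] that by simp
    moreover have "carrier H = \<phi> ` carrier G"
      using assms(1) by (simp add: epi_def)
    ultimately show "f = g"
      by (intro Homs_eqI[OF fg(1,2)]) auto
  qed
  show "(\<lambda>f. restrict (f \<circ> \<phi>) (carrier G)) ` Homs H A \<subseteq> Homs G A"
  proof (intro image_subsetI restrict_in_Homs)
    show "f \<circ> \<phi> \<in> hom G A" if "f \<in> Homs H A" for f
      using assms(1) that by (intro Group.hom_compose[of _ _ H]) (auto simp: epi_def Homs_def)
  qed
qed (rule assms)

lemma card_Homs_iso:
  assumes "G \<cong> H" "group G" "group H" "finite (carrier G)" "finite (carrier A)"
  shows "card (Homs G A) = card (Homs H A)"
proof -
  obtain \<phi> \<psi> where "\<phi> \<in> epi G H" "\<psi> \<in> epi H G"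
    using assms(1) group.iso_sym[OF assms(2,1)] by (auto simp: is_iso_def iso_iff_mon_epi)
  moreover have "finite (carrier H)"
    using iso_finite[OF assms(1)] assms(4) by simp
  ultimately show ?thesis
    using group.card_Homs_epi_le[OF assms(2)] group.card_Homs_epi_le[OF assms(3)]
      finite_Homs[OF _ assms(5)] assms(4) by (meson antisym)
qed

text \<open>This is the universal property of the quotient: composing with the projection is a
  bijection, whose inverse factors a homomorphism through \<open>G Mod N\<close>.\<close>

lemma card_Homs_Mod:
  assumes N: "N \<lhd> G" and A: "group A"
  shows "card (Homs (G Mod N) A) = card {f \<in> Homs G A. \<forall>n\<in>N. f n = \<one>\<^bsub>A\<^esub>}"
proof (rule bij_betw_same_card)
  interpret N: normal N G by (rule N)
  let ?r = "\<lambda>f. restrict (\<lambda>z. f (N #>\<^bsub>G\<^esub> z)) (carrier G)"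
  have cs: "N #>\<^bsub>G\<^esub> n = N" if "n \<in> N" for n
    using that N.coset_join2 N.subgroup_axioms N.mem_carrier by blast
  show "bij_betw ?r (Homs (G Mod N) A) {f \<in> Homs G A. \<forall>n\<in>N. f n = \<one>\<^bsub>A\<^esub>}"
    unfolding bij_betw_def
  proof (intro conjI equalityI subsetI)
    show "inj_on ?r (Homs (G Mod N) A)"
    proof (rule inj_onI)
      fix f g assume fg: "f \<in> Homs (G Mod N) A" "g \<in> Homs (G Mod N) A" "?r f = ?r g"
      have "f (N #>\<^bsub>G\<^esub> z) = g (N #>\<^bsub>G\<^esub> z)" if "z \<in> carrier G" for z
        using fun_cong[OF fg(3), of z] that by simp
      then show "f = g"
        by (intro Homs_eqI[OF fg(1,2)]) (auto simp: carrier_FactGroup)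
    qed
  next
    fix h assume "h \<in> ?r ` Homs (G Mod N) A"
    then obtain f where f: "f \<in> hom (G Mod N) A" and h: "h = ?r f"
      by (auto simp: Homs_def)
    have "h \<in> Homs G A"
      using N.restrict_in_Homs[OF Group.hom_compose[OF N.r_coset_hom_Mod f]] by (simp add: h comp_def)
    moreover have "f N = \<one>\<^bsub>A\<^esub>"
      using hom_one[OF f N.factorgroup_is_group A] by simp
    ultimately show "h \<in> {f \<in> Homs G A. \<forall>n\<in>N. f n = \<one>\<^bsub>A\<^esub>}"
      by (simp add: h cs)
  next
    fix h assume "h \<in> {f \<in> Homs G A. \<forall>n\<in>N. f n = \<one>\<^bsub>A\<^esub>}"
    then have h: "h \<in> Homs G A" "h \<in> hom G A" "\<forall>n\<in>N. h n = \<one>\<^bsub>A\<^esub>"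
      by (auto simp: Homs_def)
    interpret h: group_hom G A h
      using A h(2) by (simp add: group_hom_def group_hom_axioms_def N.is_group)
    have "N \<subseteq> kernel G A h"
      using h(3) by (auto simp: kernel_def)
    then obtain g where g: "g \<in> hom (G Mod N) A" "\<And>z. z \<in> carrier G \<Longrightarrow> g (N #>\<^bsub>G\<^esub> z) = h z"
      using h.FactGroup_universal_kernel[OF N] by blast
    have "h = ?r (restrict g (carrier (G Mod N)))"
    proof (rule ext)
      fix z show "h z = ?r (restrict g (carrier (G Mod N))) z"
      proof (cases "z \<in> carrier G")
        case True
        then have "N #>\<^bsub>G\<^esub> z \<in> carrier (G Mod N)"
          by (simp add: carrier_FactGroup)
        then show ?thesis
          using True by (simp add: g(2))
      next
        case False
        then show ?thesis
          using h(1) extensional_arb[of h "carrier G" z] by (simp add: Homs_def)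
      qed
    qed
    moreover have "restrict g (carrier (G Mod N)) \<in> Homs (G Mod N) A"
      using group.restrict_in_Homs[OF N.factorgroup_is_group g(1)] .
    ultimately show "h \<in> ?r ` Homs (G Mod N) A"
      by blast
  qed
qed

lemma (in group_hom) kills_generate_iff:
  assumes "x \<in> carrier G"
  shows "(\<forall>n\<in>generate G {x}. h n = \<one>\<^bsub>H\<^esub>) \<longleftrightarrow> h x = \<one>\<^bsub>H\<^esub>"
proof
  assume "h x = \<one>\<^bsub>H\<^esub>"
  then have "generate G {x} \<subseteq> kernel G H h"
    using assms by (intro G.generate_subgroup_incl subgroup_kernel) (auto simp: kernel_def)
  then show "\<forall>n\<in>generate G {x}. h n = \<one>\<^bsub>H\<^esub>"
    by (auto simp: kernel_def)
qed (auto intro: generate.incl)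

section \<open>Fibres and images of evaluation at a point\<close>

lemma hom_mult_pointwise:
  assumes "comm_group A" "f \<in> hom G A" "g \<in> hom G A"
  shows "(\<lambda>z. f z \<otimes>\<^bsub>A\<^esub> g z) \<in> hom G A"
proof -
  interpret A: comm_group A by fact
  show ?thesis
    using assms(2,3) by (auto simp: hom_def Pi_iff A.m_ac)
qed

lemma hom_inv_pointwise:
  assumes "comm_group A" "f \<in> hom G A"
  shows "(\<lambda>z. inv\<^bsub>A\<^esub> f z) \<in> hom G A"
proof -
  interpret A: comm_group A by fact
  show ?thesis
    using assms(2) by (auto simp: hom_def Pi_iff A.inv_mult)
qed

lemma hom_one_pointwise:
  assumes "group A"
  shows "(\<lambda>z. \<one>\<^bsub>A\<^esub>) \<in> hom G A"
proof -
  interpret A: group A by fact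
  show ?thesis
    by (auto simp: hom_def)
qed

text \<open>Pointwise multiplication by \<open>f\<^sub>0\<close> carries the fibre over the identity
  onto the fibre over \<open>f\<^sub>0 x\<close>; pointwise multiplication by its inverse leads
  back.\<close>

lemma (in group) card_Homs_fibre:
  assumes A: "comm_group A" and x: "x \<in> carrier G" and f0: "f\<^sub>0 \<in> hom G A"
  shows "card {f \<in> Homs G A. f x = f\<^sub>0 x} = card {f \<in> Homs G A. f x = \<one>\<^bsub>A\<^esub>}"
proof -
  interpret A: comm_group A by fact
  have [simp]: "f\<^sub>0 z \<in> carrier A" if "z \<in> carrier G" for z
    using f0 that by (auto simp: hom_def)
  let ?t = "\<lambda>f. \<lambda>z\<in>carrier G. f z \<otimes>\<^bsub>A\<^esub> f\<^sub>0 z"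
  let ?u = "\<lambda>f. \<lambda>z\<in>carrier G. f z \<otimes>\<^bsub>A\<^esub> inv\<^bsub>A\<^esub> f\<^sub>0 z"
  have t: "?t f \<in> Homs G A" if "f \<in> Homs G A" for f
    using restrict_in_Homs[OF hom_mult_pointwise[OF A _ f0]] that by (simp add: Homs_def)
  have u: "?u f \<in> Homs G A" if "f \<in> Homs G A" for f
    using restrict_in_Homs[OF hom_mult_pointwise[OF A _ hom_inv_pointwise[OF A f0]]] that
    by (simp add: Homs_def)
  have c: "f z \<in> carrier A" if "f \<in> Homs G A" "z \<in> carrier G" for f z
    using that by (auto simp: Homs_def hom_def)
  have "bij_betw ?t {f \<in> Homs G A. f x = \<one>\<^bsub>A\<^esub>} {f \<in> Homs G A. f x = f\<^sub>0 x}"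
  proof (rule bij_betw_byWitness[where f' = ?u])
    show "\<forall>f\<in>{f \<in> Homs G A. f x = \<one>\<^bsub>A\<^esub>}. ?u (?t f) = f"
    proof
      fix f assume "f \<in> {f \<in> Homs G A. f x = \<one>\<^bsub>A\<^esub>}"
      then have f: "f \<in> Homs G A"
        by simp
      show "?u (?t f) = f"
        by (rule Homs_eqI[OF u[OF t[OF f]] f]) (simp add: A.m_assoc c[OF f])
    qed
    show "\<forall>f\<in>{f \<in> Homs G A. f x = f\<^sub>0 x}. ?t (?u f) = f"
    proof
      fix f assume "f \<in> {f \<in> Homs G A. f x = f\<^sub>0 x}"
      then have f: "f \<in> Homs G A"
        by simp
      show "?t (?u f) = f"
        by (rule Homs_eqI[OF t[OF u[OF f]] f]) (simp add: A.m_assoc c[OF f])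
    qed
    show "?t ` {f \<in> Homs G A. f x = \<one>\<^bsub>A\<^esub>} \<subseteq> {f \<in> Homs G A. f x = f\<^sub>0 x}"
      using t x by auto
    show "?u ` {f \<in> Homs G A. f x = f\<^sub>0 x} \<subseteq> {f \<in> Homs G A. f x = \<one>\<^bsub>A\<^esub>}"
      using u x by auto
  qed
  from bij_betw_same_card[OF this] show ?thesis
    by (rule sym)
qed

text \<open>This is the image \<open>I\<^sub>x\<close>. Using \<open>hom\<close> spares restricting
  composites to the carrier; for \<open>x\<close> in the carrier, \<open>Homs\<close> yields the
  same values.\<close>

definition evals :: "('a, 'c) monoid_scheme \<Rightarrow> ('b, 'd) monoid_scheme \<Rightarrow> 'a \<Rightarrow> 'b set"
  where "evals G A x = (\<lambda>f. f x) ` hom G A"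

lemma (in group) evals_eq_Homs:
  assumes "x \<in> carrier G"
  shows "evals G A x = (\<lambda>f. f x) ` Homs G A"
proof -
  have "f x \<in> (\<lambda>f. f x) ` Homs G A" if "f \<in> hom G A" for f
    using restrict_in_Homs[OF that] assms by (force intro: image_eqI[where x = "restrict f (carrier G)"])
  then show ?thesis
    by (auto simp: evals_def Homs_def)
qed

lemma (in group) subgroup_evals:
  assumes A: "comm_group A" and x: "x \<in> carrier G"
  shows "subgroup (evals G A x) A"
proof -
  interpret A: comm_group A by fact
  show ?thesis
  proof (rule A.subgroupI)
    show "evals G A x \<subseteq> carrier A"
      using x by (auto simp: evals_def hom_def)
    show "evals G A x \<noteq> {}"
      using hom_one_pointwise[OF A.is_group] by (auto simp: evals_def)
    show "inv\<^bsub>A\<^esub> a \<in> evals G A x" if "a \<in> evals G A x" for a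
      using that by (auto simp: evals_def intro!: image_eqI[OF _ hom_inv_pointwise[OF A]])
    show "a \<otimes>\<^bsub>A\<^esub> b \<in> evals G A x" if "a \<in> evals G A x" "b \<in> evals G A x" for a b
      using that by (auto simp: evals_def intro!: image_eqI[OF _ hom_mult_pointwise[OF A]])
  qed
qed

lemma (in group) card_Homs_eq:
  assumes A: "comm_group A" and x: "x \<in> carrier G" and fin: "finite (Homs G A)"
  shows "card (Homs G A) = card (evals G A x) * card {f \<in> Homs G A. f x = \<one>\<^bsub>A\<^esub>}"
proof -
  have "card (Homs G A) = (\<Sum>a\<in>evals G A x. card {f \<in> Homs G A. f x = a})"
    using sum.image_gen[OF fin, of "\<lambda>_. 1::nat" "\<lambda>f. f x"] by (simp add: evals_eq_Homs[OF x])
  also have "\<dots> = (\<Sum>a\<in>evals G A x. card {f \<in> Homs G A. f x = \<one>\<^bsub>A\<^esub>})"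
    by (rule sum.cong) (auto simp: evals_def card_Homs_fibre[OF A x])
  finally show ?thesis
    by simp
qed

lemma (in group) card_Homs_kill:
  assumes "generate G {x} \<lhd> G" "group A" "x \<in> carrier G"
  shows "card {f \<in> Homs G A. f x = \<one>\<^bsub>A\<^esub>} = card (Homs (G Mod generate G {x}) A)"
proof -
  have "{f \<in> Homs G A. f x = \<one>\<^bsub>A\<^esub>} = {f \<in> Homs G A. \<forall>n\<in>generate G {x}. f n = \<one>\<^bsub>A\<^esub>}"
    using group_hom.kills_generate_iff[of G A _ x] assms
    by (auto simp: Homs_def group_hom_def group_hom_axioms_def)
  then show ?thesis
    using card_Homs_Mod[OF assms(1,2)] by simp
qed

section \<open>Equality of the evaluation images, first for cyclic targets\<close>

lemma (in group) cyclic_subgroup_eqI: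
  assumes cyc: "cyclic_group G" and fin: "finite (carrier G)"
    and H: "subgroup H G" and K: "subgroup K G" and card: "card H = card K"
  shows "H = K"
proof -
  obtain g where g: "g \<in> carrier G" and "subgroup_generated G {g} = G"
    using cyc by (auto simp: cyclic_group_def)
  then have C: "carrier G = generate G {g}"
    using carrier_subgroup_generated[of G "{g}"] by simp
  have n0: "ord g \<noteq> 0"
    using ord_ge_1[OF fin g] by simp
  \<comment> \<open>This describes \<open>L\<close> by its order alone. By Lagrange \<open>L\<close>
    is contained in the solution set, so it suffices that the equation has at most
    \<open>card L\<close> solutions.\<close>
  have *: "L = {h \<in> carrier G. h [^] card L = \<one>}" if L: "subgroup L G" for L
  proof (rule card_seteq)
    let ?d = "card L" and ?T = "{h \<in> carrier G. h [^] card L = \<one>}"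
    show "finite ?T"
      using fin by simp
    interpret L: group "G\<lparr>carrier := L\<rparr>"
      using L by (rule subgroup_imp_group)
    show "L \<subseteq> ?T"
      using L.pow_order_eq_1 subgroup.subset[OF L] by (auto simp: order_def simp flip: nat_pow_consistent)
    have d0: "?d > 0"
      using subgroup.one_closed[OF L] finite_subset[OF subgroup.subset[OF L] fin] by (auto simp: card_gt_0_iff)
    have "?d dvd ord g"
      using lagrange[OF L] generate_pow_card[OF g] C by (simp add: order_def) (metis dvd_triv_right)
    then obtain e where e: "ord g = ?d * e"
      by blast
    \<comment> \<open>For a solution \<open>g [^] k\<close>, \<open>?d * e\<close> divides
      \<open>k * ?d\<close>, so \<open>k\<close> is a multiple of \<open>e\<close>. Exponents only
      matter modulo \<open>?d * e\<close>, which leaves \<open>?d\<close> candidates.\<close>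
    have "?T \<subseteq> (\<lambda>i. g [^] (e * i)) ` {..<?d}"
    proof
      fix h assume h: "h \<in> ?T"
      then obtain k :: nat where k: "h = g [^] k"
        using C generate_pow_nat[OF g n0] by auto
      have "ord g dvd k * ?d"
        using h g k by (simp add: nat_pow_pow pow_eq_id)
      then have "e dvd k"
        using e d0 by (simp add: mult.commute)
      then obtain i where i: "k = e * i"
        by blast
      have "e * i = e * (i mod ?d) + ord g * (i div ?d)"
        unfolding e by (metis add.commute distrib_left mult.assoc mult.commute mult_div_mod_eq)
      then have "h = g [^] (e * (i mod ?d)) \<otimes> (g [^] ord g) [^] (i div ?d)"
        using g by (metis k i nat_pow_closed nat_pow_mult nat_pow_pow)
      then have "h = g [^] (e * (i mod ?d))"
        using g by simp
      then show "h \<in> (\<lambda>i. g [^] (e * i)) ` {..<?d}"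
        using d0 by auto
    qed
    from surj_card_le[OF finite_lessThan this] show "card ?T \<le> ?d"
      by simp
  qed
  show ?thesis
    using *[OF H] *[OF K] card by simp
qed

lemma (in comm_group) card_Homs_kill_eq:
  assumes fin: "finite (carrier G)" and x: "x \<in> carrier G" and y: "y \<in> carrier G"
    and iso: "G Mod generate G {x} \<cong> G Mod generate G {y}"
    and A: "comm_group A" "finite (carrier A)"
  shows "card {f \<in> Homs G A. f x = \<one>\<^bsub>A\<^esub>} = card {f \<in> Homs G A. f y = \<one>\<^bsub>A\<^esub>}"
proof -
  interpret A: comm_group A by fact
  have N: "generate G {z} \<lhd> G" if "z \<in> carrier G" for z
    using that by (simp add: generate_is_subgroup subgroup_imp_normal)
  have "finite (carrier (G Mod generate G {x}))"
    using fin by (simp add: carrier_FactGroup)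
  then have "card (Homs (G Mod generate G {x}) A) = card (Homs (G Mod generate G {y}) A)"
    using card_Homs_iso[OF iso] A(2) x y by (simp add: N normal.factorgroup_is_group)
  then show ?thesis
    using card_Homs_kill[OF N A.is_group] x y by simp
qed

lemma (in comm_group) evals_cyclic:
  assumes fin: "finite (carrier G)" and x: "x \<in> carrier G" and y: "y \<in> carrier G"
    and iso: "G Mod generate G {x} \<cong> G Mod generate G {y}"
    and A: "comm_group A" "finite (carrier A)" "cyclic_group A"
  shows "evals G A x = evals G A y"
proof -
  interpret A: comm_group A by fact
  have fH: "finite (Homs G A)"
    using finite_Homs[OF fin A(2)] .
  \<comment> \<open>The trivial homomorphism makes the common fibre size positive, so it can be
    cancelled from the two product formulas for \<open>card (Homs G A)\<close>.\<close>
  have "restrict (\<lambda>z. \<one>\<^bsub>A\<^esub>) (carrier G) \<in> {f \<in> Homs G A. f x = \<one>\<^bsub>A\<^esub>}" (is "_ \<in> ?K")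
    using restrict_in_Homs[OF hom_one_pointwise[OF A.is_group]] x by simp
  moreover have "finite ?K"
    using fH by simp
  ultimately have "card ?K > 0"
    unfolding card_gt_0_iff by blast
  then have "card (evals G A x) = card (evals G A y)"
    using card_Homs_eq[OF A(1) x fH] card_Homs_eq[OF A(1) y fH] card_Homs_kill_eq[OF fin x y iso A(1,2)]
    by simp
  then show ?thesis
    using A.cyclic_subgroup_eqI[OF A(3,2)] subgroup_evals[OF A(1)] x y by blast
qed

text \<open>Split off a cyclic direct factor of maximal order from \<open>A\<close> and treat the two components of a
  homomorphism separately.\<close>
lemma evals_subset:
  fixes G :: "('a, 'c) monoid_scheme" and A :: "('b, 'd) monoid_scheme"
  assumes x: "x \<in> carrier G" and cyc: "\<And>C :: ('b, 'd) monoid_scheme. \<lbrakk>comm_group C; finite (carrier C); cyclic_group C\<rbrakk> \<Longrightarrow>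
      evals G C x \<subseteq> evals G C y"
    and "comm_group A" "finite (carrier A)"
  shows "evals G A x \<subseteq> evals G A y"
  using assms(3,4)
proof (induction "card (carrier A)" arbitrary: A rule: less_induct)
  case less
  interpret A: comm_group A by fact
  show ?case
  proof (cases "cyclic_group A")
    case True
    then show ?thesis
      using cyc less.prems by blast
  next
    case False
    obtain g where g: "g \<in> carrier A" and exp: "\<And>a. a \<in> carrier A \<Longrightarrow> A.ord a dvd A.ord g"
      using A.exponent_eq_ord[OF less.prems(2)] by blast
    let ?C = "generate A {g}"
    obtain K where K: "subgroup K A" "K \<inter> ?C \<subseteq> {\<one>\<^bsub>A\<^esub>}" "K <#>\<^bsub>A\<^esub> ?C = carrier A"
      using A.cyclic_complement[OF less.prems(2) g exp] by blast
    have C: "subgroup ?C A"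
      using g by (simp add: A.generate_is_subgroup)
    \<comment> \<open>The induction needs a strictly smaller factor. If \<open>K\<close> were
      everything, \<open>g\<close> would be trivial, so all orders would be 1 and \<open>A\<close>
      would be trivial, hence cyclic.\<close>
    have "K \<noteq> carrier A"
    proof
      assume "K = carrier A"
      then have "g = \<one>\<^bsub>A\<^esub>"
        using K(2) g generate.incl[of g "{g}" A] by blast
      then have "A.ord a = 1" if "a \<in> carrier A" for a
        using exp[OF that] by simp
      then have "carrier A = {\<one>\<^bsub>A\<^esub>}"
        using A.ord_eq_1 by blast
      then show False
        using False trivial_imp_cyclic_group by (auto simp: trivial_group_def)
    qed
    let ?K = "subgroup_generated A K" and ?B = "subgroup_generated A ?C"
    have cK: "carrier ?K = K" and cC: "carrier ?B = ?C"
      using K(1) C by (simp_all add: subgroup.carrier_subgroup_generated_subgroup)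
    have IH: "evals G ?K x \<subseteq> evals G ?K y"
    proof (rule less.hyps)
      show "card (carrier ?K) < card (carrier A)"
        using \<open>K \<noteq> carrier A\<close> subgroup.subset[OF K(1)] less.prems(2) cK by (simp add: psubset_card_mono psubsetI)
      show "comm_group ?K"
        using less.prems(1) by (rule A.abelian_subgroup_generated)
      show "finite (carrier ?K)"
        using finite_subset[OF subgroup.subset[OF K(1)] less.prems(2)] cK by simp
    qed
    \<comment> \<open>\<open>?B\<close> is generated by the whole set \<open>?C\<close>; cyclicity
      is read off from the single generator \<open>g\<close>.\<close>
    have BC: "?B = subgroup_generated A {g}"
      using g by (simp add: subgroup_generated_def A.generate_incl Int_absorb1) (metis A.carrier_subgroup_generated_subset C Int_absorb1 carrier_subgroup_generated cC)
    have cycC: "evals G ?B x \<subseteq> evals G ?B y"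
    proof (rule cyc)
      show "comm_group ?B"
        using less.prems(1) by (rule A.abelian_subgroup_generated)
      show "finite (carrier ?B)"
        using finite_subset[OF subgroup.subset[OF C] less.prems(2)] cC by simp
      show "cyclic_group ?B"
        unfolding BC by (rule A.cyclic_group_generated)
    qed
    interpret S: group_disjoint_sum A K ?C
      using K C by (simp add: group_disjoint_sum_def A.is_group)
    let ?m = "\<lambda>(u, v). u \<otimes>\<^bsub>A\<^esub> v"
    have m: "?m \<in> iso (?K \<times>\<times> ?B) A"
      using S.iso_group_mul[OF less.prems(1)] K by blast
    define \<psi> where "\<psi> = inv_into (carrier (?K \<times>\<times> ?B)) ?m"
    have "group (?K \<times>\<times> ?B)"
      by (simp add: DirProd_group)
    then have \<psi>: "\<psi> \<in> hom A (?K \<times>\<times> ?B)"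
      using group.iso_set_sym[OF _ m] by (simp add: \<psi>_def iso_imp_homomorphism)
    have m\<psi>: "?m (\<psi> a) = a" if "a \<in> carrier A" for a
      using m that unfolding \<psi>_def by (intro f_inv_into_f) (auto simp: iso_iff)
    show ?thesis
    proof
      fix a assume "a \<in> evals G A x"
      then obtain f where f: "f \<in> hom G A" and a: "a = f x"
        by (auto simp: evals_def)
      have aA: "a \<in> carrier A"
        using hom_in_carrier[OF f x] a by simp
      have "(\<lambda>z. fst (\<psi> (f z))) \<in> hom G ?K" "(\<lambda>z. snd (\<psi> (f z))) \<in> hom G ?B"
        using Group.hom_compose[OF f \<psi>] by (simp_all add: hom_pairwise comp_def)
      then have "fst (\<psi> a) \<in> evals G ?K x" "snd (\<psi> a) \<in> evals G ?B x"
        by (auto simp: evals_def a)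
      \<comment> \<open>\<open>p\<close> and \<open>q\<close> are found independently, one per
        coordinate of \<open>a\<close>. Their pointwise product in \<open>A\<close> is a single
        homomorphism sending \<open>y\<close> to \<open>a\<close>.\<close>
      then obtain p q where p: "p \<in> hom G ?K" "fst (\<psi> a) = p y" and q: "q \<in> hom G ?B" "snd (\<psi> a) = q y"
        using IH cycC unfolding evals_def by blast
      have "p \<in> hom G A" "q \<in> hom G A"
        using p(1) q(1) by (simp_all add: hom_into_subgroup_eq_gen A.is_group)
      then have "(\<lambda>z. p z \<otimes>\<^bsub>A\<^esub> q z) \<in> hom G A"
        by (rule hom_mult_pointwise[OF less.prems(1)])
      moreover have "a = p y \<otimes>\<^bsub>A\<^esub> q y"
        using m\<psi>[OF aA] p(2) q(2) by (simp add: case_prod_beta)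
      ultimately show "a \<in> evals G A y"
        by (auto simp: evals_def)
    qed
  qed
qed

section \<open>From prescribed values to surjective homomorphisms\<close>

lemma (in comm_group) card_Homs_value_eq:
  assumes fin: "finite (carrier G)" and x: "x \<in> carrier G" and y: "y \<in> carrier G"
    and iso: "G Mod generate G {x} \<cong> G Mod generate G {y}"
    and A: "comm_group A" "finite (carrier A)"
  shows "card {f \<in> Homs G A. f x = a} = card {f \<in> Homs G A. f y = a}"
proof -
  have ev: "evals G A x = evals G A y"
  proof
    show "evals G A x \<subseteq> evals G A y"
      by (rule evals_subset[OF x _ A]) (simp add: evals_cyclic[OF fin x y iso])
    show "evals G A y \<subseteq> evals G A x"
      by (rule evals_subset[OF y _ A]) (simp add: evals_cyclic[OF fin x y iso])
  qed
  show ?thesis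
  \<comment> \<open>Inside the common image both fibres have the size of the fibre over the
    identity; outside it both are empty.\<close>
  proof (cases "a \<in> evals G A x")
    case True
    then obtain f g where f: "f \<in> hom G A" "f x = a" and g: "g \<in> hom G A" "g y = a"
      using ev unfolding evals_def by (metis (no_types, lifting) imageE)
    show ?thesis
      using card_Homs_fibre[OF A(1) x f(1)] card_Homs_fibre[OF A(1) y g(1)]
        card_Homs_kill_eq[OF fin x y iso A] by (simp add: f(2) g(2))
  next
    case False
    have *: "{f \<in> Homs G A. f z = a} = {}" if "a \<notin> evals G A z" for z
      using that by (auto simp: evals_def Homs_def)
    then show ?thesis
      using *[OF False] *[OF False[unfolded ev]] by (simp only:)
  qed
qed

text \<open>Homomorphisms into \<open>B\<close> are sorted by their image, a subgroup
  \<open>B'\<close> of \<open>B\<close>. The totals for \<open>x\<close> and \<open>y\<close> agree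
  by \<open>eq\<close>, and the terms for proper \<open>B'\<close> agree by induction, so the
  remaining terms, for image \<open>B\<close>, agree too.\<close>

lemma (in group) card_surj_homs_eq:
  assumes finG: "finite (carrier G)" and A: "group A" "finite (carrier A)"
    and eq: "\<And>B. subgroup B A \<Longrightarrow> card {f \<in> Homs G (subgroup_generated A B). f x = a} =
      card {f \<in> Homs G (subgroup_generated A B). f y = a}"
    and B: "subgroup B A"
  shows "card {f \<in> Homs G A. f x = a \<and> f ` carrier G = B} =
    card {f \<in> Homs G A. f y = a \<and> f ` carrier G = B}"
proof -
  let ?s = "\<lambda>z B. {f \<in> Homs G A. f z = a \<and> f ` carrier G = B}"
  have fin: "finite (Homs G A)"
    using finite_Homs[OF finG A(2)] .
  have "finite B"
    using finite_subset[OF subgroup.subset[OF B] A(2)] .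
  then show ?thesis
    using B
  proof (induction B rule: finite_psubset_induct)
    case (psubset B)
    let ?S = "{B'. subgroup B' A \<and> B' \<subseteq> B}"
    have finS: "finite ?S"
      by (rule finite_subset[of _ "Pow B"]) (auto simp: psubset.hyps)
    have "card {f \<in> Homs G (subgroup_generated A B). f z = a} = (\<Sum>B'\<in>?S. card (?s z B'))" for z
    proof -
      have "{f \<in> Homs G (subgroup_generated A B). f z = a} = (\<Union>B'\<in>?S. ?s z B')"
        using group_hom.img_is_subgroup[of G A] A(1) group_axioms
        by (auto simp: Homs_def hom_into_subgroup_eq[OF psubset.prems A(1)] group_hom_def group_hom_axioms_def)
      then show ?thesis
        using fin finS by (simp only:) (rule card_UN_disjoint, auto)
    qed
    then have "(\<Sum>B'\<in>?S. card (?s x B')) = (\<Sum>B'\<in>?S. card (?s y B'))"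
      using eq[OF psubset.prems] by simp
    moreover have "(\<Sum>B'\<in>?S - {B}. card (?s x B')) = (\<Sum>B'\<in>?S - {B}. card (?s y B'))"
      using psubset.IH by (intro sum.cong) auto
    ultimately show ?case
      using finS psubset.prems by (simp add: sum.remove[of _ B])
  qed
qed

section \<open>The easy direction, and the assembly of both directions\<close>

lemma (in group) FactGroup_generate_iso:
  assumes \<phi>: "\<phi> \<in> iso G H" and H: "comm_group H" and x: "x \<in> carrier G"
  shows "G Mod generate G {x} \<cong> H Mod generate H {\<phi> x}"
proof -
  interpret H: comm_group H by fact
  let ?N = "generate H {\<phi> x}"
  have hom: "\<phi> \<in> hom G H" and inj: "inj_on \<phi> (carrier G)" and onto: "\<phi> ` carrier G = carrier H"
    using \<phi> by (auto simp: iso_iff)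
  interpret h: group_hom G H \<phi>
    using hom by (simp add: group_hom_def group_hom_axioms_def is_group H.is_group)
  have N: "?N \<lhd> H"
    using x by (simp add: H.generate_is_subgroup H.subgroup_imp_normal)
  interpret N: normal ?N H by (rule N)
  \<comment> \<open>\<open>\<phi>\<close> followed by the projection is onto, and its kernel is the
    preimage of \<open>?N\<close>. Since \<open>?N\<close> is the image of
    \<open>generate G {x}\<close> and \<open>\<phi>\<close> is injective, the first isomorphism
    theorem applies with kernel \<open>generate G {x}\<close>.\<close>
  let ?h = "\<lambda>z. ?N #>\<^bsub>H\<^esub> \<phi> z"
  interpret h': group_hom G "H Mod ?N" ?h
    using Group.hom_compose[OF hom N.r_coset_hom_Mod]
    by (simp add: group_hom_def group_hom_axioms_def is_group N.factorgroup_is_group comp_def)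
  have im: "?N = \<phi> ` generate G {x}"
    using h.generate_img[of "{x}"] x by simp
  have coset: "?h z = ?N \<longleftrightarrow> \<phi> z \<in> ?N" if "z \<in> carrier G" for z
    using that H.coset_join1 H.coset_join2 N.subgroup_axioms N.subset h.hom_closed by metis
  have sub: "generate G {x} \<subseteq> carrier G"
    using x by (simp add: generate_incl)
  have "kernel G (H Mod ?N) ?h = {z \<in> carrier G. \<phi> z \<in> ?N}"
    using coset by (auto simp only: kernel_def one_FactGroup)
  also have "\<dots> = generate G {x}"
    using inj sub unfolding im inj_on_def by blast
  finally have "kernel G (H Mod ?N) ?h = generate G {x}" .
  moreover have "?h ` carrier G = carrier (H Mod ?N)"
    by (simp add: carrier_FactGroup image_image flip: onto)
  ultimately show ?thesis
    using h'.FactGroup_iso by simp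
qed

theorem theorem2p1:
  fixes G (structure) and x y
  assumes "comm_group G" and "finite (carrier G)"
    and "x \<in> carrier G" and "y \<in> carrier G"
  shows "(\<exists>\<phi> \<in> auto G. \<phi> x = y) \<longleftrightarrow>
         (G Mod generate G {x}) \<cong> (G Mod generate G {y})"
proof
  interpret comm_group G by fact
  show "G Mod generate G {x} \<cong> G Mod generate G {y}" if "\<exists>\<phi> \<in> auto G. \<phi> x = y"
    using that FactGroup_generate_iso[OF _ assms(1,3)] by (auto simp: auto_def Bij_def iso_def)
  assume iso: "G Mod generate G {x} \<cong> G Mod generate G {y}"
  note fin = assms(2) and x = assms(3) and y = assms(4)
  have "card {f \<in> Homs G (subgroup_generated G B). f x = y} = card {f \<in> Homs G (subgroup_generated G B). f y = y}"
    for B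
    using finite_subset[OF carrier_subgroup_generated_subset fin] abelian_subgroup_generated[OF assms(1)]
    by (intro card_Homs_value_eq[OF fin x y iso])
  then have card: "card {f \<in> Homs G G. f x = y \<and> f ` carrier G = carrier G} =
      card {f \<in> Homs G G. f y = y \<and> f ` carrier G = carrier G}" (is "card ?S = card ?T")
    by (rule card_surj_homs_eq[OF fin is_group fin _ subgroup_self])
  have "finite ?T"
    using finite_Homs[OF fin fin] by simp
  moreover have "(\<lambda>z\<in>carrier G. z) \<in> ?T"
    using restrict_in_Homs[of "\<lambda>z. z" G] y by (simp add: hom_def)
  ultimately have "card ?T > 0"
    unfolding card_gt_0_iff by blast
  then have "?S \<noteq> {}"
    unfolding card[symmetric] card_gt_0_iff by (rule conjunct1)
  then obtain f where f: "f \<in> Homs G G" "f x = y" "f ` carrier G = carrier G"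
    by blast
  have "inj_on f (carrier G)"
    using fin f(3) by (simp add: eq_card_imp_inj_on)
  \<comment> \<open>\<open>auto\<close> also demands extensionality on the carrier, which membership
    in \<open>Homs\<close> supplies.\<close>
  then have "f \<in> auto G"
    using f by (simp add: auto_def Bij_def bij_betw_def Homs_def)
  then show "\<exists>\<phi> \<in> auto G. \<phi> x = y"
    using f(2) by blast
qed

end
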